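(* Let $a<0$ and $b<0$ be integers. For each height $n\ge1$ there are only finitely many non-commutative friezes of height $n$ over $(a,b)_{\mathbb{Z}}\setminus\{0\}$ with all boundary entries equal to $1$.
   Context: For non-zero integers $a,b$, the quaternion algebra $(a,b)_{\mathbb{Q}}$ is the 4-dimensional associative $\mathbb{Q}$-algebra with basis $1,\mathrm{i},\mathrm{j},\mathrm{k}$ and relations $\mathrm{i}^2=a$, $\mathrm{j}^2=b$, $\mathrm{i}\mathrm{j}=\mathrm{k}=-\mathrm{j}\mathrm{i}$. For $a,b<0$ it is a division ring. The Lipschitz subring is $(a,b)_{\mathbb{Z}}=\{\alpha+\beta\mathrm{i}+\gamma\mathrm{j}+\delta\mathrm{k} : \alpha,\beta,\gamma,\delta\in\mathbb{Z}\}$. Non-commutative friezes. Let $D$ be a division ring and let $\mathcal{P}$ be an $m$-gon ($m\ge3$) with vertices $0,1,\dots,m-1$ in cyclic order (indices modulo $m$). Let $\mathrm{diag}(\mathcal{P})$ be the set of ordered pairs of distinct vertices (edges included, both orientations). A non-commutative frieze over $D$ on $\mathcal{P}$ is a map $c:\mathrm{diag}(\mathcal{P})\to D\setminus\{0\}$, $(r,s)\mapsto c_{r,s}$, satisfying: (a) for all $r$: $c_{r+1,r+2}c_{r,r+2}^{-1}c_{r,r+1}=c_{r+1,r}c_{r+2,r}^{-1}c_{r+2,r+1}$; (b) for all $r,s$ with $r,r+1,s,s+1$ pairwise distinct: $c_{s,r}=c_{s,s+1}c_{r+1,s+1}^{-1}c_{r+1,r}+c_{s,r+1}c_{s+1,r+1}^{-1}c_{s+1,r}$,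 $c_{r,s}=c_{r,r+1}c_{s+1,r+1}^{-1}c_{s+1,s}+c_{r,s+1}c_{r+1,s+1}^{-1}c_{r+1,s}$, $c_{r+1,s+1}=c_{r+1,r}c_{s,r}^{-1}c_{s,s+1}+c_{r+1,s}c_{r,s}^{-1}c_{r,s+1}$, $c_{s+1,r+1}=c_{s+1,s}c_{r,s}^{-1}c_{r,r+1}+c_{s+1,r}c_{s,r}^{-1}c_{s,r+1}$. The boundary entries are the $c_{r,r+1}$ and $c_{r+1,r}$. The frieze has height $n$ if $m=n+3$. A non-commutative frieze over $(a,b)_{\mathbb{Z}}\setminus\{0\}$ is a non-commutative frieze over $D=(a,b)_{\mathbb{Q}}$ all of whose entries lie in $(a,b)_{\mathbb{Z}}\setminus\{0\}$ (inverses are taken in $(a,b)_{\mathbb{Q}}$). *)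

theory Defs
  imports "HOL-Algebra.Algebra"
begin

datatype quat = Quat (qre: rat) (qi: rat) (qj: rat) (qk: rat)

text \<open>The quaternion algebra over the rationals with parameters \<open>a\<close>, \<open>b\<close>, where
  \<open>Quat p q r s\<close> stands for \<open>p + q i + r j + s k\<close>. The product is the bilinear extension of
  \<open>ii = a\<close>, \<open>jj = b\<close>, \<open>ij = k = -ji\<close>, which force \<open>kk = -ab\<close>, \<open>ik = aj = -ki\<close>, \<open>kj = bi = -jk\<close>.\<close>

definition quat_alg :: "int \<Rightarrow> int \<Rightarrow> quat ring" where
  "quat_alg a b = \<lparr>
     carrier = UNIV,
     monoid.mult = (\<lambda>x y. Quat
       (qre x * qre y + of_int a * (qi x * qi y) + of_int b * (qj x * qj y)
          - of_int a * of_int b * (qk x * qk y))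
       (qre x * qi y + qi x * qre y - of_int b * (qj x * qk y) + of_int b * (qk x * qj y))
       (qre x * qj y + qj x * qre y + of_int a * (qi x * qk y) - of_int a * (qk x * qi y))
       (qre x * qk y + qk x * qre y + qi x * qj y - qj x * qi y)),
     one = Quat 1 0 0 0,
     ring.zero = Quat 0 0 0 0,
     ring.add = (\<lambda>x y. Quat (qre x + qre y) (qi x + qi y) (qj x + qj y) (qk x + qk y))\<rparr>"

definition lipschitz :: "quat set" where
  "lipschitz = {Quat (of_int p) (of_int q) (of_int r) (of_int s) | p q r s :: int. True}"

locale skew_field = ring D for D (structure) +
  assumes one_neq_zero: "\<one> \<noteq> \<zero>"
    and units_eq: "Units D = carrier D - {\<zero>}"

definition diag :: "nat \<Rightarrow> (nat \<times> nat) set" where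
  "diag m = {(r, s). r < m \<and> s < m \<and> r \<noteq> s}"

text \<open>A frieze is an extensional function on \<open>diag m\<close> (it is \<open>undefined\<close> elsewhere), so that
  counting friezes counts maps with domain \<open>diag m\<close>. The cyclic successor of a vertex \<open>r\<close> of the
  \<open>m\<close>-gon is \<open>Suc r mod m\<close>.\<close>

locale nc_frieze = skew_field D for D (structure) +
  fixes m :: nat and c :: "nat \<times> nat \<Rightarrow> 'a"
  assumes m_ge_3: "3 \<le> m"
    and entries: "c \<in> diag m \<rightarrow>\<^sub>E carrier D - {\<zero>}"
    and triangle:
      "\<And>r r1 r2. \<lbrakk>r < m; r1 = Suc r mod m; r2 = Suc r1 mod m\<rbrakk> \<Longrightarrow>
        c (r1, r2) \<otimes> inv c (r, r2) \<otimes> c (r, r1) = c (r1, r) \<otimes> inv c (r2, r) \<otimes> c (r2, r1)"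
    and exchange:
      "\<And>r s r1 s1. \<lbrakk>r < m; s < m; r1 = Suc r mod m; s1 = Suc s mod m; distinct [r, r1, s, s1]\<rbrakk> \<Longrightarrow>
        c (s, r) = c (s, s1) \<otimes> inv c (r1, s1) \<otimes> c (r1, r) \<oplus> c (s, r1) \<otimes> inv c (s1, r1) \<otimes> c (s1, r) \<and>
        c (r, s) = c (r, r1) \<otimes> inv c (s1, r1) \<otimes> c (s1, s) \<oplus> c (r, s1) \<otimes> inv c (r1, s1) \<otimes> c (r1, s) \<and>
        c (r1, s1) = c (r1, r) \<otimes> inv c (s, r) \<otimes> c (s, s1) \<oplus> c (r1, s) \<otimes> inv c (r, s) \<otimes> c (r, s1) \<and>
        c (s1, r1) = c (s1, s) \<otimes> inv c (r, s) \<otimes> c (r, r1) \<oplus> c (s1, r) \<otimes> inv c (s, r) \<otimes> c (s, r1)"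

lemma quat_alg_ring: "ring (quat_alg a b)"
proof (rule ringI)
  show "abelian_group (quat_alg a b)"
  proof (rule abelian_groupI)
    fix x assume "x \<in> carrier (quat_alg a b)"
    show "\<exists>y\<in>carrier (quat_alg a b). y \<oplus>\<^bsub>quat_alg a b\<^esub> x = \<zero>\<^bsub>quat_alg a b\<^esub>"
      by (rule bexI[of _ "Quat (- qre x) (- qi x) (- qj x) (- qk x)"]) (simp_all add: quat_alg_def)
  qed (simp_all add: quat_alg_def quat.expand)
  show "Group.monoid (quat_alg a b)"
    by (rule monoidI) (simp_all add: quat_alg_def quat.expand algebra_simps)
qed (simp_all add: quat_alg_def algebra_simps)

lemma quat_alg_relations:
  fixes a b :: int
  defines "i \<equiv> Quat 0 1 0 0" and "j \<equiv> Quat 0 0 1 0" and "k \<equiv> Quat 0 0 0 1"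
  shows "i \<otimes>\<^bsub>quat_alg a b\<^esub> i = Quat (of_int a) 0 0 0"
    and "j \<otimes>\<^bsub>quat_alg a b\<^esub> j = Quat (of_int b) 0 0 0"
    and "i \<otimes>\<^bsub>quat_alg a b\<^esub> j = k"
    and "j \<otimes>\<^bsub>quat_alg a b\<^esub> i = \<ominus>\<^bsub>quat_alg a b\<^esub> k"
proof -
  interpret ring "quat_alg a b" by (rule quat_alg_ring)
  have "Quat 0 0 0 (-1) = \<ominus>\<^bsub>quat_alg a b\<^esub> k"
    by (rule minus_equality[symmetric]) (simp_all add: quat_alg_def k_def)
  then show "j \<otimes>\<^bsub>quat_alg a b\<^esub> i = \<ominus>\<^bsub>quat_alg a b\<^esub> k"
    by (simp add: quat_alg_def i_def j_def)
qed (simp_all add: quat_alg_def i_def j_def k_def)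

lemma lipschitz_subring: "subring lipschitz (quat_alg a b)"
proof -
  interpret ring "quat_alg a b" by (rule quat_alg_ring)
  have minus: "\<ominus>\<^bsub>quat_alg a b\<^esub> Quat p q r s = Quat (- p) (- q) (- r) (- s)" for p q r s
    by (rule minus_equality) (simp_all add: quat_alg_def)
  have mem: "Quat p q r s \<in> lipschitz \<longleftrightarrow> p \<in> \<int> \<and> q \<in> \<int> \<and> r \<in> \<int> \<and> s \<in> \<int>" for p q r s
    by (auto simp: lipschitz_def elim!: Ints_cases)
  show ?thesis
  proof (rule subringI)
    fix h assume "h \<in> lipschitz"
    then show "\<ominus>\<^bsub>quat_alg a b\<^esub> h \<in> lipschitz"
      by (cases h) (simp add: minus mem)
  next
    fix h g assume "h \<in> lipschitz" "g \<in> lipschitz"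
    then show "h \<otimes>\<^bsub>quat_alg a b\<^esub> g \<in> lipschitz" "h \<oplus>\<^bsub>quat_alg a b\<^esub> g \<in> lipschitz"
      by (cases h; cases g; simp add: quat_alg_def mem)+
  qed (simp_all add: quat_alg_def mem)
qed

lemma quat_alg_skew_field:
  assumes "a < 0" "b < 0"
  shows "skew_field (quat_alg a b)"
proof -
  interpret ring "quat_alg a b" by (rule quat_alg_ring)
  show ?thesis
  proof
    show 10: "\<one>\<^bsub>quat_alg a b\<^esub> \<noteq> \<zero>\<^bsub>quat_alg a b\<^esub>" by (simp add: quat_alg_def)
    have "x \<in> Units (quat_alg a b)" if "x \<noteq> \<zero>\<^bsub>quat_alg a b\<^esub>" for x
    proof -
      obtain p q r s where x: "x = Quat p q r s" by (cases x)
      define A B :: rat where "A = of_int a" and "B = of_int b"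
      define N where "N = p * p + (- A) * (q * q) + (- B) * (r * r) + (A * B) * (s * s)"
      have AB: "- A > 0" "- B > 0" "A * B > 0"
        using assms by (auto simp: A_def B_def mult_neg_neg)
      have ge: "p * p \<ge> 0" "(- A) * (q * q) \<ge> 0" "(- B) * (r * r) \<ge> 0" "(A * B) * (s * s) \<ge> 0"
        using AB by (intro mult_nonneg_nonneg zero_le_square less_imp_le; simp)+
      have "N \<noteq> 0"
      proof
        assume "N = 0"
        with ge have "p * p = 0 \<and> (- A) * (q * q) = 0 \<and> (- B) * (r * r) = 0 \<and> (A * B) * (s * s) = 0"
          unfolding N_def by linarith
        with AB have "p = 0 \<and> q = 0 \<and> r = 0 \<and> s = 0" by auto
        with that show False by (simp add: x quat_alg_def)
      qed
      define y where "y = Quat (p / N) (- q / N) (- r / N) (- s / N)"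
      have one: "p * (p / N) - A * (q * (q / N)) - B * (r * (r / N)) + A * B * (s * (s / N)) = 1"
        using \<open>N \<noteq> 0\<close> by (simp add: field_simps) (simp add: N_def algebra_simps)
      have "x \<otimes>\<^bsub>quat_alg a b\<^esub> y = \<one>\<^bsub>quat_alg a b\<^esub>" "y \<otimes>\<^bsub>quat_alg a b\<^esub> x = \<one>\<^bsub>quat_alg a b\<^esub>"
        using one unfolding x y_def A_def B_def by (simp_all add: quat_alg_def algebra_simps)
      then show ?thesis unfolding Units_def by (auto simp: quat_alg_def)
    qed
    moreover have "\<zero>\<^bsub>quat_alg a b\<^esub> \<notin> Units (quat_alg a b)"
      using 10 by (auto simp: Units_def)
    ultimately show "Units (quat_alg a b) = carrier (quat_alg a b) - {\<zero>\<^bsub>quat_alg a b\<^esub>}"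
      by (auto simp: quat_alg_def)
  qed
qed

end

theory Submission
  imports Defs
begin

text \<open>The proof bounds the norm \<open>N\<close> of every entry by a constant that depends only on the number
  \<open>m = n + 3\<close> of vertices. Only finitely many Lipschitz quaternions lie below such a bound, and
  \<open>diag m\<close> is finite, so finitely many friezes remain.

  For the bound, write \<open>r'\<close> and \<open>s'\<close> for the successors of \<open>r\<close> and \<open>s\<close>. With boundary entries \<open>1\<close>, the
  second exchange relation, multiplied by \<open>c(s', r')\<close> from the right, says that
  \<open>c(r, s) c(s', r') - 1\<close> equals \<open>q = c(r, s') c(r', s')\<^sup>-\<^sup>1 c(r', s) c(s', r')\<close>.
  The left-hand side is a Lipschitz quaternion and the right-hand side is non-zero, so \<open>N q \<ge> 1\<close>. A
  Lipschitz quaternion of norm at least \<open>1\<close> cannot be much smaller than its translate by \<open>1\<close>: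
  \<open>N (1 + q) \<le> 2 + 2 N q \<le> 4 N q\<close>. As \<open>N\<close> is multiplicative, the factors \<open>N (c(s', r'))\<close> cancel,
  which leaves a multiplicative inequality between four entries of the frieze
  (\<open>frieze_norm_local_bound\<close>):
  \<open>N (c(r, s)) N (c(r', s')) \<le> 4 N (c(r, s')) N (c(r', s))\<close>.

  Take logarithms and let \<open>S d\<close> be the sum of \<open>ln (N (c(r, r + d)))\<close> over all vertices \<open>r\<close>. Summing the
  inequality around the polygon gives \<open>2 S d \<le> S (d - 1) + S (d + 1) + m ln 4\<close>, and \<open>S\<close> vanishes at
  the two boundary distances \<open>d = 1\<close> and \<open>d = m - 1\<close>. A discrete maximum principle
  (\<open>almost_convex_bound\<close>) compares \<open>S\<close> with a parabola and bounds it. Every summand is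
  non-negative because norms of entries are at least \<open>1\<close>, so the bound on \<open>S d\<close> bounds each entry.\<close>

section \<open>A discrete maximum principle\<close>

lemma midpoint_convex_nonpos:
  fixes f :: "nat \<Rightarrow> real"
  assumes ends: "f 0 \<le> 0" "f n \<le> 0"
    and mid: "\<And>k. Suc k < n \<Longrightarrow> 2 * f (Suc k) \<le> f k + f (Suc (Suc k))"
    and "k \<le> n"
  shows "f k \<le> 0"
proof -
  define M where "M = Max (f ` {..n})"
  have le_M: "f i \<le> M" if "i \<le> n" for i
    using that by (auto simp: M_def)
  have "M \<in> f ` {..n}"
    unfolding M_def by (rule Max_in) auto
  then have ex: "\<exists>i. i \<le> n \<and> f i = M" by auto
  \<comment> \<open>At the least maximiser, an interior position would force the left neighbour to be maximal too.\<close>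
  define i where "i = (LEAST i. i \<le> n \<and> f i = M)"
  have i: "i \<le> n" "f i = M"
    using LeastI_ex[OF ex] by (auto simp: i_def)
  have "i = 0 \<or> i = n"
  proof (rule ccontr)
    assume "\<not> (i = 0 \<or> i = n)"
    then obtain j where j: "i = Suc j" "Suc j < n"
      using i(1) by (cases i) auto
    have "f j = M"
      using mid[OF j(2)] i(2) le_M[of j] le_M[of "Suc (Suc j)"] j by simp
    then have "i \<le> j"
      unfolding i_def using j by (intro Least_le) auto
    with j show False by simp
  qed
  then have "M \<le> 0" using i(2) ends by auto
  with le_M[OF \<open>k \<le> n\<close>] show ?thesis by simp
qed

text \<open>The parabola \<open>k \<mapsto> C k (n - k)\<close> vanishes at both ends and has constant second difference
  \<open>- 2 C\<close>, so subtracting it removes the defect \<open>2 C\<close> in the convexity inequality.\<close>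

lemma almost_convex_bound:
  fixes S :: "nat \<Rightarrow> real"
  assumes ends: "S 0 \<le> 0" "S n \<le> 0"
    and mid: "\<And>k. Suc k < n \<Longrightarrow> 2 * S (Suc k) \<le> S k + S (Suc (Suc k)) + 2 * C"
    and "k \<le> n"
  shows "S k \<le> C * (real k * (real n - real k))"
proof -
  define f where "f k = S k - C * (real k * (real n - real k))" for k
  have "f k \<le> 0"
  proof (rule midpoint_convex_nonpos[OF _ _ _ \<open>k \<le> n\<close>])
    fix j assume "Suc j < n"
    from mid[OF this] show "2 * f (Suc j) \<le> f j + f (Suc (Suc j))"
      by (simp add: f_def algebra_simps)
  qed (use ends in \<open>simp_all add: f_def\<close>)
  then show ?thesis by (simp add: f_def)
qed

section \<open>The norm of a quaternion\<close>

definition qnorm :: "int \<Rightarrow> int \<Rightarrow> quat \<Rightarrow> rat" where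
  "qnorm a b x = (qre x)\<^sup>2 + of_int (- a) * (qi x)\<^sup>2 + of_int (- b) * (qj x)\<^sup>2
     + of_int (a * b) * (qk x)\<^sup>2"

text \<open>Euler's four-square identity for the form \<open>\<langle>1, -A, -B, AB\<rangle>\<close>.\<close>

lemma four_squares_identity:
  fixes A B :: "'a::idom"
  shows "(p * p' + A * (q * q') + B * (r * r') - A * B * (s * s'))\<^sup>2
   - A * (p * q' + q * p' - B * (r * s') + B * (s * r'))\<^sup>2
   - B * (p * r' + r * p' + A * (q * s') - A * (s * q'))\<^sup>2
   + A * B * (p * s' + s * p' + q * r' - r * q')\<^sup>2
   = (p\<^sup>2 - A * q\<^sup>2 - B * r\<^sup>2 + A * B * s\<^sup>2) * (p'\<^sup>2 - A * q'\<^sup>2 - B * r'\<^sup>2 + A * B * s'\<^sup>2)"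
  by Groebner_Basis.algebra

lemma qnorm_mult: "qnorm a b (x \<otimes>\<^bsub>quat_alg a b\<^esub> y) = qnorm a b x * qnorm a b y"
  using four_squares_identity[of "qre x" "qre y" "of_int a" "qi x" "qi y" "of_int b"
      "qj x" "qj y" "qk x" "qk y"]
  by (simp add: qnorm_def quat_alg_def)

lemma qnorm_one [simp]: "qnorm a b \<one>\<^bsub>quat_alg a b\<^esub> = 1"
  by (simp add: qnorm_def quat_alg_def)

text \<open>The coefficients \<open>- a\<close>, \<open>- b\<close> and \<open>a b\<close> of the norm form are positive integers, hence at
  least \<open>1\<close>.\<close>

lemma coordinates_le_qnorm:
  assumes "a < 0" "b < 0"
  shows "(qre x)\<^sup>2 \<le> qnorm a b x" "(qi x)\<^sup>2 \<le> qnorm a b x"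
    "(qj x)\<^sup>2 \<le> qnorm a b x" "(qk x)\<^sup>2 \<le> qnorm a b x"
proof -
  have scale: "0 \<le> of_int k * y\<^sup>2 \<and> y\<^sup>2 \<le> of_int k * y\<^sup>2" if "1 \<le> k" for k :: int and y :: rat
  proof -
    have "1 * y\<^sup>2 \<le> of_int k * y\<^sup>2"
      using that by (intro mult_right_mono) auto
    then show ?thesis by (smt (verit) mult_1 zero_le_power2 order_trans)
  qed
  have "0 < a * b" using assms by (rule mult_neg_neg)
  then have "1 \<le> - a" "1 \<le> - b" "1 \<le> a * b" using assms by auto
  note s = this[THEN scale]
  note facts = s(1)[of "qi x"] s(2)[of "qj x"] s(3)[of "qk x"] zero_le_power2[of "qre x"]
  show "(qre x)\<^sup>2 \<le> qnorm a b x" "(qi x)\<^sup>2 \<le> qnorm a b x"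
    "(qj x)\<^sup>2 \<le> qnorm a b x" "(qk x)\<^sup>2 \<le> qnorm a b x"
    using facts unfolding qnorm_def by linarith+
qed

lemma qnorm_nonneg:
  assumes "a < 0" "b < 0"
  shows "0 \<le> qnorm a b x"
  using coordinates_le_qnorm(1)[OF assms] zero_le_power2 by (rule order_trans[rotated])

lemma qnorm_one_add_le:
  assumes "a < 0" "b < 0"
  shows "qnorm a b (\<one>\<^bsub>quat_alg a b\<^esub> \<oplus>\<^bsub>quat_alg a b\<^esub> x) \<le> 2 + 2 * qnorm a b x"
proof -
  \<comment> \<open>The parallelogram law: the difference of both sides is the norm of \<open>x - 1\<close>.\<close>
  have "qnorm a b (\<one>\<^bsub>quat_alg a b\<^esub> \<oplus>\<^bsub>quat_alg a b\<^esub> x)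
      + qnorm a b (Quat (qre x - 1) (qi x) (qj x) (qk x)) = 2 + 2 * qnorm a b x"
    by (simp add: qnorm_def quat_alg_def power2_eq_square algebra_simps)
  moreover have "0 \<le> qnorm a b (Quat (qre x - 1) (qi x) (qj x) (qk x))"
    by (rule qnorm_nonneg[OF assms])
  ultimately show ?thesis by simp
qed

lemma lipschitz_iff:
  "x \<in> lipschitz \<longleftrightarrow> qre x \<in> \<int> \<and> qi x \<in> \<int> \<and> qj x \<in> \<int> \<and> qk x \<in> \<int>"
  by (cases x) (auto simp: lipschitz_def elim!: Ints_cases)

lemma qnorm_pos:
  assumes "a < 0" "b < 0" "x \<noteq> \<zero>\<^bsub>quat_alg a b\<^esub>"
  shows "0 < qnorm a b x"
proof (rule ccontr)
  assume "\<not> 0 < qnorm a b x"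
  then have "(qre x)\<^sup>2 \<le> 0" "(qi x)\<^sup>2 \<le> 0" "(qj x)\<^sup>2 \<le> 0" "(qk x)\<^sup>2 \<le> 0"
    using coordinates_le_qnorm[OF assms(1,2), of x] by linarith+
  then show False using assms(3) by (auto simp: quat_alg_def quat.expand)
qed

lemma qnorm_nonzero_imp_ge_1:
  assumes "x \<in> lipschitz" "0 < qnorm a b x"
  shows "1 \<le> qnorm a b x"
proof -
  have "qnorm a b x \<in> \<int>"
    using assms(1) by (simp add: lipschitz_iff qnorm_def)
  then obtain k where "qnorm a b x = of_int k" by (elim Ints_cases)
  with assms(2) show ?thesis by simp
qed

lemma finite_lipschitz_bounded:
  assumes "a < 0" "b < 0"
  shows "finite {x \<in> lipschitz. of_rat (qnorm a b x) \<le> (B :: real)}"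
proof -
  define I where "I = {- \<lfloor>B\<rfloor>..\<lfloor>B\<rfloor>}"
  have coordinate: "t \<in> of_int ` I" if t: "t \<in> \<int>" "of_rat (t\<^sup>2) \<le> B" for t :: rat
  proof -
    obtain k where k: "t = of_int k" using t(1) by (elim Ints_cases)
    have "real_of_int (k\<^sup>2) \<le> B" using t(2) by (simp add: k of_rat_power)
    then have "k\<^sup>2 \<le> \<lfloor>B\<rfloor>" by (simp only: le_floor_iff)
    moreover have "\<bar>k\<bar> \<le> k\<^sup>2"
      using self_le_power[of "\<bar>k\<bar>" 2] by (cases "k = 0") auto
    ultimately have "k \<in> I" by (auto simp: I_def)
    then show ?thesis by (simp add: k)
  qed
  have "{x \<in> lipschitz. of_rat (qnorm a b x) \<le> B}
      \<subseteq> (\<lambda>(p, q, r, s). Quat (of_int p) (of_int q) (of_int r) (of_int s)) ` (I \<times> I \<times> I \<times> I)"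
    (is "_ \<subseteq> ?f ` _")
  proof
    fix x assume "x \<in> {x \<in> lipschitz. of_rat (qnorm a b x) \<le> B}"
    then have x: "x \<in> lipschitz" "of_rat (qnorm a b x) \<le> B" by auto
    have le: "of_rat (t\<^sup>2) \<le> B" if "t\<^sup>2 \<le> qnorm a b x" for t
      using that x(2) by (meson of_rat_less_eq order_trans)
    have "qre x \<in> of_int ` I" "qi x \<in> of_int ` I" "qj x \<in> of_int ` I" "qk x \<in> of_int ` I"
      using x(1) coordinates_le_qnorm[OF assms, of x]
      by (auto intro!: coordinate le simp: lipschitz_iff)
    then obtain p q r s where "p \<in> I" "q \<in> I" "r \<in> I" "s \<in> I"
      "x = ?f (p, q, r, s)"
      by (cases x) auto
    then show "x \<in> ?f ` (I \<times> I \<times> I \<times> I)" by blast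
  qed
  moreover have "finite (I \<times> I \<times> I \<times> I)" by (simp add: I_def)
  ultimately show ?thesis by (meson finite_imageI finite_subset)
qed

section \<open>Vertices of a polygon\<close>

lemma polygon_step_inj:
  fixes r i j m :: nat
  assumes "i < m" "j < m" "(r + i) mod m = (r + j) mod m"
  shows "i = j"
proof (rule ccontr)
  assume "i \<noteq> j"
  have "m dvd max i j - min i j"
    using assms(3) mod_eq_dvd_iff_nat[of "r + i" "r + j" m] mod_eq_dvd_iff_nat[of "r + j" "r + i" m]
    by (auto simp: max_def min_def)
  with \<open>i \<noteq> j\<close> have "m \<le> max i j - min i j"
    by (intro dvd_imp_le) auto
  with assms(1,2) show False by auto
qed

lemma polygon_reach:
  fixes r s m :: nat
  assumes "r < m" "s < m" "r \<noteq> s"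
  obtains d where "1 \<le> d" "d \<le> m - 1" "s = (r + d) mod m"
proof (cases "r < s")
  case True
  then show ?thesis using assms that[of "s - r"] by simp
next
  case False
  then have "r + (s + m - r) = s + m" using assms by simp
  then show ?thesis using False assms by (intro that[of "s + m - r"]) auto
qed

lemma sum_rotate_polygon:
  fixes g :: "nat \<Rightarrow> real"
  assumes "0 < m"
  shows "(\<Sum>r<m. g (Suc r mod m)) = (\<Sum>r<m. g r)"
proof -
  have "inj_on (\<lambda>r. Suc r mod m) {..<m}"
    by (rule inj_onI, rule polygon_step_inj[of _ m _ 1]) simp_all
  moreover have "(\<lambda>r. Suc r mod m) ` {..<m} \<subseteq> {..<m}"
    using assms by auto
  ultimately have "bij_betw (\<lambda>r. Suc r mod m) {..<m} {..<m}"
    by (simp add: bij_betw_def endo_inj_surj)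
  then show ?thesis by (rule sum.reindex_bij_betw)
qed

section \<open>Bounding the entries of a frieze\<close>

definition lipschitz_frieze :: "int \<Rightarrow> int \<Rightarrow> nat \<Rightarrow> (nat \<times> nat \<Rightarrow> quat) \<Rightarrow> bool" where
  "lipschitz_frieze a b m c \<longleftrightarrow> nc_frieze (quat_alg a b) m c
      \<and> (\<forall>d \<in> diag m. c d \<in> lipschitz - {\<zero>\<^bsub>quat_alg a b\<^esub>})
      \<and> (\<forall>r < m. c (r, Suc r mod m) = \<one>\<^bsub>quat_alg a b\<^esub>
               \<and> c (Suc r mod m, r) = \<one>\<^bsub>quat_alg a b\<^esub>)"

lemma lipschitz_frieze_entry_ge_1:
  assumes "a < 0" "b < 0" "lipschitz_frieze a b m c" "d \<in> diag m"
  shows "1 \<le> qnorm a b (c d)"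
  using assms by (auto simp: lipschitz_frieze_def intro!: qnorm_nonzero_imp_ge_1 qnorm_pos)

text \<open>This is where integrality enters: two distinct Lipschitz quaternions, here \<open>1\<close> and
  \<open>c(r, s) c(s', r')\<close>, have a difference of norm at least \<open>1\<close>.\<close>

lemma frieze_norm_local_bound:
  assumes ab: "a < 0" "b < 0" and c: "lipschitz_frieze a b m c"
    and rs: "r < m" "s < m" "r1 = Suc r mod m" "s1 = Suc s mod m" "distinct [r, r1, s, s1]"
  shows "qnorm a b (c (r, s)) * qnorm a b (c (r1, s1))
    \<le> 4 * (qnorm a b (c (r, s1)) * qnorm a b (c (r1, s)))"
proof -
  let ?N = "qnorm a b"
  interpret nc_frieze "quat_alg a b" m c using c by (simp add: lipschitz_frieze_def)
  have carr [simp]: "x \<in> carrier (quat_alg a b)" for x by (simp add: quat_alg_def)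
  have r1s1: "r1 < m" "s1 < m" using rs by auto
  have pos: "0 < ?N (c d)" if "d \<in> diag m" for d
    using lipschitz_frieze_entry_ge_1[OF ab c that] by linarith
  define V Y Z W where "V = c (r, s1)" and "Y = c (r1, s1)" and "Z = c (r1, s)" and "W = c (s1, r1)"
  define q where "q = V \<otimes>\<^bsub>quat_alg a b\<^esub> inv\<^bsub>quat_alg a b\<^esub> Y \<otimes>\<^bsub>quat_alg a b\<^esub> Z \<otimes>\<^bsub>quat_alg a b\<^esub> W"
  have in_diag: "(r, s) \<in> diag m" "(r, s1) \<in> diag m" "(r1, s1) \<in> diag m" "(r1, s) \<in> diag m"
    "(s1, r1) \<in> diag m"
    using rs r1s1 by (auto simp: diag_def)
  note npos = in_diag[THEN pos, folded V_def Y_def Z_def W_def]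
  have units: "Y \<in> Units (quat_alg a b)" "W \<in> Units (quat_alg a b)"
    using c in_diag by (auto simp: lipschitz_frieze_def units_eq Y_def W_def)
  have bd: "c (r, r1) = \<one>\<^bsub>quat_alg a b\<^esub>" "c (s1, s) = \<one>\<^bsub>quat_alg a b\<^esub>"
    using c rs by (auto simp: lipschitz_frieze_def)
  have "c (r, s) = inv\<^bsub>quat_alg a b\<^esub> W \<oplus>\<^bsub>quat_alg a b\<^esub> V \<otimes>\<^bsub>quat_alg a b\<^esub> inv\<^bsub>quat_alg a b\<^esub> Y \<otimes>\<^bsub>quat_alg a b\<^esub> Z"
  proof -
    have "c (r, s) = c (r, r1) \<otimes>\<^bsub>quat_alg a b\<^esub> inv\<^bsub>quat_alg a b\<^esub> W \<otimes>\<^bsub>quat_alg a b\<^esub> c (s1, s)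
        \<oplus>\<^bsub>quat_alg a b\<^esub> V \<otimes>\<^bsub>quat_alg a b\<^esub> inv\<^bsub>quat_alg a b\<^esub> Y \<otimes>\<^bsub>quat_alg a b\<^esub> Z"
      unfolding V_def Y_def Z_def W_def using exchange[OF rs] by blast
    then show ?thesis by (simp add: bd)
  qed
  then have eq: "c (r, s) \<otimes>\<^bsub>quat_alg a b\<^esub> W = \<one>\<^bsub>quat_alg a b\<^esub> \<oplus>\<^bsub>quat_alg a b\<^esub> q"
    using units by (simp add: q_def l_distr Units_l_inv)
  have "c (r, s) \<in> lipschitz" "W \<in> lipschitz"
    using c in_diag by (auto simp: lipschitz_frieze_def W_def)
  then have "\<one>\<^bsub>quat_alg a b\<^esub> \<oplus>\<^bsub>quat_alg a b\<^esub> q \<in> lipschitz"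
    unfolding eq[symmetric] using subringE(6)[OF lipschitz_subring] by blast
  then have q_lip: "q \<in> lipschitz"
    by (auto simp: lipschitz_iff quat_alg_def dest: Ints_diff[OF _ Ints_1])
  have "?N (inv\<^bsub>quat_alg a b\<^esub> Y) * ?N Y = 1"
    using units(1) by (metis Units_l_inv qnorm_mult qnorm_one)
  then have Nq: "?N q * ?N Y = ?N V * ?N Z * ?N W"
    by (simp add: q_def qnorm_mult algebra_simps)
  have "0 < ?N q * ?N Y" unfolding Nq using npos by simp
  then have "0 < ?N q" using npos by (simp add: zero_less_mult_iff)
  then have "1 \<le> ?N q" by (rule qnorm_nonzero_imp_ge_1[OF q_lip])
  then have "?N (c (r, s)) * ?N W \<le> 4 * ?N q"
    using qnorm_one_add_le[OF ab, of q] by (simp flip: qnorm_mult add: eq)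
  then have "?N (c (r, s)) * ?N W * ?N Y \<le> 4 * ?N q * ?N Y"
    using npos by (intro mult_right_mono) auto
  also have "\<dots> = 4 * (?N V * ?N Z) * ?N W" using Nq by simp
  finally have "(?N (c (r, s)) * ?N Y) * ?N W \<le> (4 * (?N V * ?N Z)) * ?N W"
    by (simp add: mult_ac)
  then show ?thesis using npos by (simp add: V_def Y_def Z_def)
qed

lemma frieze_norm_bound:
  assumes ab: "a < 0" "b < 0" and c: "lipschitz_frieze a b m c" and p: "p \<in> diag m"
  shows "of_rat (qnorm a b (c p)) \<le> exp (real m * ln 4 * (real m)\<^sup>2)"
proof -
  define h where "h r d = ln (of_rat (qnorm a b (c (r, (r + d) mod m))) :: real)" for r d
  define S where "S d = (\<Sum>r<m. h r d)" for d
  have m: "3 \<le> m" using c by (simp add: lipschitz_frieze_def nc_frieze_def nc_frieze_axioms_def)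
  have ge_1: "1 \<le> (of_rat (qnorm a b (c d)) :: real)" if "d \<in> diag m" for d
    using lipschitz_frieze_entry_ge_1[OF ab c that] by (metis of_rat_1 of_rat_less_eq)
  have step_diag: "(r, (r + d) mod m) \<in> diag m" if "r < m" "1 \<le> d" "d \<le> m - 1" for r d
  proof -
    have "(r + d) mod m \<noteq> (r + 0) mod m"
    proof
      assume "(r + d) mod m = (r + 0) mod m"
      then have "d = 0" by (rule polygon_step_inj[rotated 2]) (use that in auto)
      with that show False by simp
    qed
    with that show ?thesis by (simp add: diag_def)
  qed
  have h_nonneg: "0 \<le> h r d" if "r < m" "1 \<le> d" "d \<le> m - 1" for r d
    using ge_1[OF step_diag[OF that]] by (simp add: h_def)
  have local: "h r d + h (Suc r mod m) d \<le> h r (Suc d) + h (Suc r mod m) (d - 1) + ln 4"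
    if r: "r < m" and d: "2 \<le> d" "d \<le> m - 2" for r d
  proof -
    define r1 s s1 where "r1 = Suc r mod m" and "s = (r + d) mod m" and "s1 = Suc s mod m"
    have lt: "r1 < m" "s < m" "s1 < m" using m by (auto simp: r1_def s_def s1_def)
    have s1: "s1 = (r + Suc d) mod m" "s1 = (r1 + d) mod m"
      by (simp_all add: s1_def s_def r1_def mod_simps)
    have "Suc r + (d - 1) = r + d" using d by simp
    then have s: "s = (r1 + (d - 1)) mod m"
      unfolding s_def r1_def by (metis mod_add_left_eq)
    \<comment> \<open>The four vertices are reached from \<open>r\<close> in \<open>0\<close>, \<open>1\<close>, \<open>d\<close> and \<open>d + 1\<close> steps, all less than \<open>m\<close>.\<close>
    have "inj_on (\<lambda>i. (r + i) mod m) {0, 1, d, Suc d}"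
      by (rule inj_onI, rule polygon_step_inj[of _ m _ r]) (use d m in auto)
    then have "distinct (map (\<lambda>i. (r + i) mod m) [0, 1, d, Suc d])"
      using d by (simp only: distinct_map) simp
    moreover have "map (\<lambda>i. (r + i) mod m) [0, 1, d, Suc d] = [r, r1, s, s1]"
      using r by (simp add: r1_def s_def s1(1))
    ultimately have dist: "distinct [r, r1, s, s1]" by simp
    let ?R = "\<lambda>x. of_rat (qnorm a b (c x)) :: real"
    have in_diag: "(r, s) \<in> diag m" "(r, s1) \<in> diag m" "(r1, s1) \<in> diag m" "(r1, s) \<in> diag m"
      using dist r lt by (auto simp: diag_def)
    have pos: "0 < ?R x" if "x \<in> diag m" for x using ge_1[OF that] by linarith
    note npos = in_diag[THEN pos]
    have "?R (r, s) * ?R (r1, s1) \<le> 4 * (?R (r, s1) * ?R (r1, s))"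
    proof -
      have "of_rat (qnorm a b (c (r, s)) * qnorm a b (c (r1, s1)))
          \<le> (of_rat (4 * (qnorm a b (c (r, s1)) * qnorm a b (c (r1, s)))) :: real)"
        unfolding of_rat_less_eq
        by (rule frieze_norm_local_bound[OF ab c r lt(2) r1_def s1_def dist])
      then show ?thesis by (simp add: of_rat_mult)
    qed
    then have "ln (?R (r, s) * ?R (r1, s1)) \<le> ln (4 * (?R (r, s1) * ?R (r1, s)))"
      using npos by (intro ln_mono) auto
    then have "ln (?R (r, s)) + ln (?R (r1, s1)) \<le> ln 4 + ln (?R (r, s1)) + ln (?R (r1, s))"
      using npos by (simp add: ln_mult)
    then show ?thesis
      unfolding h_def r1_def[symmetric] s_def[symmetric] s1[symmetric] s[symmetric] by simp
  qed
  have convex: "2 * S d \<le> S (d - 1) + S (Suc d) + real m * ln 4" if "2 \<le> d" "d \<le> m - 2" for d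
  proof -
    have rotate: "(\<Sum>r<m. h (Suc r mod m) e) = S e" for e
      unfolding S_def by (rule sum_rotate_polygon) (use m in simp)
    have "(\<Sum>r<m. h r d + h (Suc r mod m) d)
        \<le> (\<Sum>r<m. h r (Suc d) + h (Suc r mod m) (d - 1) + ln 4)"
      by (rule sum_mono) (use local that in simp)
    then show ?thesis
      by (simp add: sum.distrib rotate) (simp add: S_def)
  qed
  have S_1: "S 1 = 0"
    using c by (simp add: S_def h_def lipschitz_frieze_def)
  have S_last: "S (m - 1) = 0"
  proof -
    \<comment> \<open>Going \<open>m - 1\<close> steps forward is going one step back.\<close>
    have "h (Suc r mod m) (m - 1) = 0" if "r < m" for r
    proof -
      have "(Suc r mod m + (m - 1)) mod m = r"
      proof -
        have "Suc r + (m - 1) = r + m" using m by simp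
        then show ?thesis using that by (metis mod_add_left_eq mod_add_self2 mod_less)
      qed
      then show ?thesis using c that by (simp add: h_def lipschitz_frieze_def)
    qed
    then have "(\<Sum>r<m. h (Suc r mod m) (m - 1)) = 0" by simp
    then show ?thesis
      unfolding S_def using sum_rotate_polygon[of m "\<lambda>r. h r (m - 1)"] m by simp
  qed
  obtain r s where rs: "p = (r, s)" "r < m" "s < m" "r \<noteq> s" using p by (auto simp: diag_def)
  obtain d where d: "1 \<le> d" "d \<le> m - 1" "s = (r + d) mod m" using polygon_reach[OF rs(2-4)] .
  \<comment> \<open>The maximum principle is applied to distances counted from \<open>1\<close>.\<close>
  have "S (Suc (d - 1))
      \<le> (real m * ln 4 / 2) * (real (d - 1) * (real (m - 2) - real (d - 1)))"
  proof (rule almost_convex_bound[where S = "\<lambda>k. S (Suc k)"])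
    fix k assume "Suc k < m - 2"
    then show "2 * S (Suc (Suc k)) \<le> S (Suc k) + S (Suc (Suc (Suc k))) + 2 * (real m * ln 4 / 2)"
      using convex[of "Suc (Suc k)"] by simp
  next
    have "Suc (m - 2) = m - 1" using m by simp
    then show "S (Suc (m - 2)) \<le> 0" using S_last by simp
  qed (use S_1 d in auto)
  \<comment> \<open>A crude estimate suffices: the bound only has to be independent of \<open>c\<close>.\<close>
  also have "\<dots> \<le> (real m * ln 4) * (real m * real m)"
  proof (rule mult_mono)
    show "real (d - 1) * (real (m - 2) - real (d - 1)) \<le> real m * real m"
      using d m by (intro mult_mono) auto
  qed (use d m in auto)
  finally have "S d \<le> real m * ln 4 * (real m)\<^sup>2"
    using d by (simp add: power2_eq_square)
  moreover have "h r d \<le> S d"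
    unfolding S_def by (rule member_le_sum) (use rs d h_nonneg in auto)
  ultimately have "ln (of_rat (qnorm a b (c p))) \<le> real m * ln 4 * (real m)\<^sup>2"
    by (simp add: h_def rs d)
  moreover have "0 < (of_rat (qnorm a b (c p)) :: real)" using ge_1[OF p] by linarith
  ultimately show ?thesis by (metis exp_le_cancel_iff exp_ln)
qed

lemma finite_lipschitz_friezes:
  assumes ab: "a < 0" "b < 0"
  shows "finite {c. lipschitz_frieze a b m c}"
proof (rule finite_subset)
  let ?B = "{x \<in> lipschitz. of_rat (qnorm a b x) \<le> exp (real m * ln 4 * (real m)\<^sup>2)}"
  show "{c. lipschitz_frieze a b m c} \<subseteq> diag m \<rightarrow>\<^sub>E ?B"
  proof
    fix c assume "c \<in> {c. lipschitz_frieze a b m c}"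
    then have c: "lipschitz_frieze a b m c" by simp
    then interpret nc_frieze "quat_alg a b" m c by (simp add: lipschitz_frieze_def)
    have "c p \<in> ?B" if "p \<in> diag m" for p
      using frieze_norm_bound[OF ab c that] c that by (auto simp: lipschitz_frieze_def)
    with entries show "c \<in> diag m \<rightarrow>\<^sub>E ?B" by (auto simp: PiE_def)
  qed
  have "finite (diag m)"
    by (rule finite_subset[of _ "{..<m} \<times> {..<m}"]) (auto simp: diag_def)
  then show "finite (diag m \<rightarrow>\<^sub>E ?B)"
    by (intro finite_PiE finite_lipschitz_bounded[OF ab])
qed

theorem corollary5p6:
  fixes a b :: int and n :: nat
  assumes "a < 0" and "b < 0" and "n \<ge> 1"
  shows "finite {c. nc_frieze (quat_alg a b) (n + 3) c
      \<and> (\<forall>d \<in> diag (n + 3). c d \<in> lipschitz - {\<zero>\<^bsub>quat_alg a b\<^esub>})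
      \<and> (\<forall>r < n + 3. c (r, Suc r mod (n + 3)) = \<one>\<^bsub>quat_alg a b\<^esub>
                   \<and> c (Suc r mod (n + 3), r) = \<one>\<^bsub>quat_alg a b\<^esub>)}"
  using finite_lipschitz_friezes[OF assms(1,2), of "n + 3"] by (simp only: lipschitz_frieze_def)

end
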